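(* Let $A, B \subset \mathbb{R}^n$ be non-empty compact sets which admit an external Hausdorff distance with radius $r > 0$. Consider uniform grids with spacing $h>0$ that are large enough. Then, for $h \to 0$, the approximation error $\delta = d_H(A,B) - \tilde{d}(A,B)$ satisfies $$\delta \le \frac{n}{2} \frac{h^2}{r} + O(h^3),$$ i.e. there exist constants $K, h_0 > 0$ such that $\delta \le \frac{n}{2}\frac{h^2}{r} + K h^3$ for every large enough grid with spacing $h \le h_0$.
   Context: $|\cdot|$ is the Euclidean norm on $\mathbb{R}^n$; $\overline{B_s(p)}$ is the closed ball of radius $s$ around $p$. For a set $\Omega \subset \mathbb{R}^n$, $d_\Omega(x) = \inf_{y \in \Omega} |x-y|$. The Hausdorff distance is $d_H(A,B) = \max(d(A \to B), d(B \to A))$ with $d(A \to B) = \sup_{x \in A} \inf_{y \in B} |x-y|$. External Hausdorff distance: assume $d_H(A,B) = d(A \to B) = |x-y| > 0$ with $x \in A$ and $y \in B$. Let $r>0$ and set $d = (x-y)/|x-y|$, $c = x + r d$ and $R = r + d_H(A,B)$. One says that $A$ and $B$ admit an external Hausdorff distance with radius $r$ if $\overline{B_r(c)} \cap A = \{x\}$ and $\overline{B_R(c)} \cap B = \{y\}$. Grid: a bounded rectangular grid in $\mathbb{R}^n$ with uniform spacing $h>0$ in each dimension, i.e. $N = \{p + h j : j \in \mathbb{Z}^n,\ 0 \le j_i \le K_i \text{ for } i=1,\dots,n\}$ for some $p \in \mathbb{R}^n$ and integers $K_i \ge 1$, is the finite set of grid points. The grid cells are the cubes of side length $h$ whose corners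 are grid points. The grid is large enough if every point of $A \cup B$ and every point of the external line segment $\{x + \tau d : 0 \le \tau \le r\}$ (from $x$ to $c$) lies in some closed grid cell. The grid approximation of the Hausdorff distance is $\tilde{d}(A,B) = \max_{z \in N} |d_A(z) - d_B(z)|$. *)

theory Defs
  imports "HOL-Analysis.Analysis"
begin

definition directed_dist :: "'a::metric_space set \<Rightarrow> 'a set \<Rightarrow> real" where
  "directed_dist A B = (SUP x\<in>A. infdist x B)"

definition hausdorff_dist :: "'a::metric_space set \<Rightarrow> 'a set \<Rightarrow> real" where
  "hausdorff_dist A B = max (directed_dist A B) (directed_dist B A)"

definition ext_dir :: "'a::real_normed_vector \<Rightarrow> 'a \<Rightarrow> 'a" where
  "ext_dir x y = (x - y) /\<^sub>R norm (x - y)"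

text \<open>
  The notion is oriented: the Hausdorff distance is attained from \<open>A\<close> to \<open>B\<close>.
  The points \<open>x\<close> and \<open>y\<close> attaining it are explicit parameters, because the
  external segment that a grid has to cover depends on them.
\<close>
definition external_hausdorff_dist ::
    "'a::real_normed_vector set \<Rightarrow> 'a set \<Rightarrow> real \<Rightarrow> 'a \<Rightarrow> 'a \<Rightarrow> bool" where
  "external_hausdorff_dist A B r x y \<longleftrightarrow>
     x \<in> A \<and> y \<in> B \<and> r > 0 \<and>
     hausdorff_dist A B = directed_dist A B \<and> directed_dist A B = norm (x - y) \<and>
     norm (x - y) > 0 \<and>
     (let c = x + r *\<^sub>R ext_dir x y; R = r + hausdorff_dist A B
      in cball c r \<inter> A = {x} \<and> cball c R \<inter> B = {y})"

definition external_segment :: "'a::real_normed_vector \<Rightarrow> 'a \<Rightarrow> real \<Rightarrow> 'a set" where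
  "external_segment x y r = {x + \<tau> *\<^sub>R ext_dir x y | \<tau>. 0 \<le> \<tau> \<and> \<tau> \<le> r}"

definition uniform_grid :: "real \<Rightarrow> (real ^ 'n) set \<Rightarrow> bool" where
  "uniform_grid h N \<longleftrightarrow>
     h > 0 \<and>
     (\<exists>(p :: real ^ 'n) (K :: int ^ 'n). (\<forall>i. K $ i \<ge> 1) \<and>
        N = {p + h *\<^sub>R (\<chi> i. real_of_int (j $ i)) | j :: int ^ 'n.
               \<forall>i. 0 \<le> j $ i \<and> j $ i \<le> K $ i})"

text \<open>
  The corners of the cube \<open>cbox q (q + h *\<^sub>R 1)\<close> are the points obtained from
  \<open>q\<close> by adding \<open>h\<close> in the coordinates belonging to an arbitrary index set \<open>S\<close>;
  here \<open>1 :: real ^ 'n\<close> is the all-ones vector.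
  A cube of side \<open>h\<close> with all corners in a grid of spacing \<open>h\<close> is axis-parallel.
\<close>
definition cube_corners :: "real \<Rightarrow> real ^ 'n \<Rightarrow> (real ^ 'n) set" where
  "cube_corners h q = {q + h *\<^sub>R (\<chi> i. if i \<in> S then 1 else 0) | S :: 'n set. True}"

definition grid_cells :: "real \<Rightarrow> (real ^ 'n) set \<Rightarrow> (real ^ 'n) set set" where
  "grid_cells h N = {cbox q (q + h *\<^sub>R 1) | q. cube_corners h q \<subseteq> N}"

definition large_enough ::
    "real \<Rightarrow> (real ^ 'n) set \<Rightarrow> (real ^ 'n) set \<Rightarrow> (real ^ 'n) set \<Rightarrow> real \<Rightarrow>
       real ^ 'n \<Rightarrow> real ^ 'n \<Rightarrow> bool" where
  "large_enough h N A B r x y \<longleftrightarrow>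
     A \<union> B \<union> external_segment x y r \<subseteq> \<Union> (grid_cells h N)"

definition grid_hausdorff_dist :: "'a::metric_space set \<Rightarrow> 'a set \<Rightarrow> 'a set \<Rightarrow> real" where
  "grid_hausdorff_dist N A B = Max ((\<lambda>z. \<bar>infdist z A - infdist z B\<bar>) ` N)"

end

(*
  Evaluate the distance difference at the grid point z nearest to the midpoint m of the
  external segment from x to c.  The ball around c of radius R has no point of B in its
  interior, so d_B(z) - d_A(z) >= R - |z - c| - |z - x|.  With v = z - m and a = (x - c) / 2,
  the sum |z - c| + |z - x| = |v + a| + |v - a| is, by the parallelogram law, at most
  r + 2 |v|^2 / r, and |v|^2 <= n h^2 / 4.  This gives the
  leading term for every h, without a cubic remainder.
*)
theory Submission
  imports Defs
begin

text \<open>The maximum in \<open>grid_hausdorff_dist\<close> bounds its members only over a finite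
  set. Index vectors are wrapped functions from a finite product of integer intervals.\<close>

lemma finite_uniform_grid:
  fixes N :: "(real ^ 'n) set"
  assumes "uniform_grid h N"
  shows "finite N"
proof -
  obtain p and K :: "int ^ 'n" where
    N: "N = {p + h *\<^sub>R (\<chi> i. real_of_int (j $ i)) | j. \<forall>i. 0 \<le> j $ i \<and> j $ i \<le> K $ i}"
    using assms unfolding uniform_grid_def by blast
  have "{j. \<forall>i. 0 \<le> j $ i \<and> j $ i \<le> K $ i} \<subseteq> vec_lambda ` (\<Pi>\<^sub>E i\<in>UNIV. {0..K $ i})"
  proof
    fix j assume "j \<in> {j. \<forall>i. 0 \<le> j $ i \<and> j $ i \<le> K $ i}"
    then have "vec_nth j \<in> (\<Pi>\<^sub>E i\<in>UNIV. {0..K $ i})" by auto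
    then have "vec_lambda (vec_nth j) \<in> vec_lambda ` (\<Pi>\<^sub>E i\<in>UNIV. {0..K $ i})" by (rule imageI)
    then show "j \<in> vec_lambda ` (\<Pi>\<^sub>E i\<in>UNIV. {0..K $ i})" by simp
  qed
  moreover have "finite (vec_lambda ` (\<Pi>\<^sub>E i\<in>(UNIV :: 'n set). {0..K $ i}))"
    by (intro finite_imageI finite_PiE) auto
  ultimately have "finite {j. \<forall>i. 0 \<le> j $ i \<and> j $ i \<le> K $ i}"
    by (rule finite_subset)
  then show ?thesis unfolding N by (rule finite_image_set)
qed

text \<open>Rounding each coordinate of \<open>m\<close> to the nearer end of its cell edge costs at
  most \<open>h / 2\<close> per coordinate.\<close>

lemma cell_corner_near:
  fixes q m :: "real ^ 'n"
  assumes m: "m \<in> cbox q (q + h *\<^sub>R 1)"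
  obtains z where "z \<in> cube_corners h q" "(norm (z - m))\<^sup>2 \<le> real CARD('n) * h\<^sup>2 / 4"
proof -
  \<comment> \<open>The coordinates to round up: those where \<open>m\<close> lies in the upper half
    of the edge.\<close>
  define S where "S = {i. m $ i > q $ i + h / 2}"
  define z where "z = q + h *\<^sub>R (\<chi> i. if i \<in> S then 1 else 0)"
  have coord: "((z - m) $ i)\<^sup>2 \<le> h\<^sup>2 / 4" for i
  proof -
    have "q $ i \<le> m $ i" "m $ i \<le> q $ i + h"
      using m by (auto simp: mem_box_cart)
    then have "\<bar>(z - m) $ i\<bar> \<le> h / 2"
      by (auto simp: z_def S_def)
    then have "\<bar>(z - m) $ i\<bar>\<^sup>2 \<le> (h / 2)\<^sup>2"
      by (intro power_mono) auto
    then show ?thesis by (simp add: power_divide)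
  qed
  have "(norm (z - m))\<^sup>2 = (\<Sum>i\<in>UNIV. ((z - m) $ i)\<^sup>2)"
    by (simp add: norm_vec_def L2_set_def sum_nonneg)
  also have "\<dots> \<le> (\<Sum>i\<in>(UNIV :: 'n set). h\<^sup>2 / 4)"
    by (intro sum_mono coord)
  finally have "(norm (z - m))\<^sup>2 \<le> real CARD('n) * h\<^sup>2 / 4" by simp
  moreover have "z \<in> cube_corners h q"
    unfolding cube_corners_def z_def by blast
  ultimately show ?thesis using that by blast
qed

lemma norm_add_diff_le:
  fixes v a :: "'a::real_inner"
  assumes "a \<noteq> 0"
  shows "norm (v + a) + norm (v - a) \<le> 2 * norm a + (norm v)\<^sup>2 / norm a"
proof -
  have a: "norm a > 0" using assms by simp
  have "(norm (v + a))\<^sup>2 + (norm (v - a))\<^sup>2 = 2 * (norm v)\<^sup>2 + 2 * (norm a)\<^sup>2"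
    by (simp add: power2_norm_eq_inner inner_simps inner_commute)
  \<comment> \<open>Replaces each square \<open>s\<^sup>2\<close> by its tangent at
    \<open>norm a\<close>, the common value of both norms at \<open>v = 0\<close>; this makes the
    parallelogram law linear in the norms.\<close>
  moreover have "0 \<le> (norm (v + a) - norm a)\<^sup>2 + (norm (v - a) - norm a)\<^sup>2" by simp
  ultimately have "norm a * (norm (v + a) + norm (v - a)) \<le> 2 * (norm a)\<^sup>2 + (norm v)\<^sup>2"
    by (simp add: power2_diff algebra_simps)
  then show ?thesis
    using a by (simp add: field_simps power2_eq_square)
qed

lemma external_hausdorff_dist_infdist_ge:
  assumes "external_hausdorff_dist A B r x y"
  shows "infdist z B \<ge> r + hausdorff_dist A B - dist z (x + r *\<^sub>R ext_dir x y)"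
proof -
  let ?H = "hausdorff_dist A B"
  define c where "c = x + r *\<^sub>R ext_dir x y"
  have y: "y \<in> B" and r: "r > 0" and H: "?H = norm (x - y)" and pos: "norm (x - y) > 0"
    and ball: "cball c (r + ?H) \<inter> B = {y}"
    using assms unfolding external_hausdorff_dist_def Let_def c_def by argo+
  \<comment> \<open>The points \<open>y\<close>, \<open>x\<close>, \<open>c\<close> lie on one line
    in this order, so \<open>y\<close> is on the sphere of radius \<open>r + ?H\<close> around
    \<open>c\<close>.\<close>
  have "c - y = (norm (x - y) + r) *\<^sub>R ext_dir x y"
    using pos by (simp add: c_def ext_dir_def algebra_simps)
  moreover have "norm (ext_dir x y) = 1"
    using pos by (simp add: ext_dir_def)
  ultimately have cy: "dist c y = r + ?H"
    using r by (simp add: dist_norm H)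
  have far: "r + ?H \<le> dist c b" if "b \<in> B" for b
  proof (cases "b = y")
    case False
    with that ball have "b \<notin> cball c (r + ?H)" by blast
    then show ?thesis by simp
  qed (simp add: cy)
  have "r + ?H - dist z c \<le> dist z b" if "b \<in> B" for b
    using far[OF that] dist_triangle[of c b z] by (simp add: dist_commute)
  \<comment> \<open>Since \<open>y \<in> B\<close>, \<open>infdist\<close> is a true infimum here,
    not its default 0 for the empty set.\<close>
  then show ?thesis
    using y unfolding infdist_def c_def[symmetric] by (auto intro!: cINF_greatest)
qed

theorem theorem5:
  fixes A B :: "(real ^ 'n) set" and r :: real and x y :: "real ^ 'n"
  assumes "A \<noteq> {}" and "compact A"
    and "B \<noteq> {}" and "compact B"
    and "r > 0"
    and "external_hausdorff_dist A B r x y"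
  shows "\<exists>K h\<^sub>0 :: real. K > 0 \<and> h\<^sub>0 > 0 \<and>
           (\<forall>(h :: real) (N :: (real ^ 'n) set).
              uniform_grid h N \<and> h \<le> h\<^sub>0 \<and> large_enough h N A B r x y \<longrightarrow>
              hausdorff_dist A B - grid_hausdorff_dist N A B
                \<le> real CARD('n) / 2 * (h\<^sup>2 / r) + K * h ^ 3)"
proof -
  define d where "d = ext_dir x y"
  define m where "m = x + (r / 2) *\<^sub>R d"
  have x: "x \<in> A" and "norm (x - y) > 0"
    using assms(6) unfolding external_hausdorff_dist_def by blast+
  then have norm_d: "norm d = 1" by (simp add: d_def ext_dir_def)
  have bound: "hausdorff_dist A B - grid_hausdorff_dist N A B \<le> real CARD('n) / 2 * (h\<^sup>2 / r)"
    if grid: "uniform_grid h N" and large: "large_enough h N A B r x y" for h N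
  proof -
    have "m \<in> external_segment x y r"
      unfolding external_segment_def m_def d_def using \<open>r > 0\<close>
      by (intro CollectI exI[of _ "r / 2"]) auto
    then obtain q where q: "cube_corners h q \<subseteq> N" "m \<in> cbox q (q + h *\<^sub>R 1)"
      using large unfolding large_enough_def grid_cells_def by blast
    then obtain z where "z \<in> N" and z: "(norm (z - m))\<^sup>2 \<le> real CARD('n) * h\<^sup>2 / 4"
      using cell_corner_near by blast
    \<comment> \<open>Half the segment, so that \<open>x\<close> is \<open>m - ?a\<close> and its
      other end is \<open>m + ?a\<close>. The opposite sign of \<open>a\<close> would only swap the
      two norms.\<close>
    let ?a = "(r / 2) *\<^sub>R d"
    have "z - x = (z - m) + ?a" "z - (x + r *\<^sub>R d) = (z - m) - ?a"
      using scaleR_left_distrib[of "r / 2" "r / 2" d] by (auto simp: m_def)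
    then have sum: "dist z x + dist z (x + r *\<^sub>R d) = norm ((z - m) + ?a) + norm ((z - m) - ?a)"
      by (simp only: dist_norm)
    have "?a \<noteq> 0" "norm ?a = r / 2"
      using norm_d \<open>r > 0\<close> by auto
    then have "dist z x + dist z (x + r *\<^sub>R d) \<le> r + (norm (z - m))\<^sup>2 / (r / 2)"
      unfolding sum using norm_add_diff_le[of ?a "z - m"] by simp
    also have "\<dots> \<le> r + (real CARD('n) * h\<^sup>2 / 4) / (r / 2)"
      using z \<open>r > 0\<close> by (intro add_left_mono divide_right_mono) auto
    also have "\<dots> = r + real CARD('n) / 2 * (h\<^sup>2 / r)" by simp
    finally have "dist z x + dist z (x + r *\<^sub>R d) \<le> r + real CARD('n) / 2 * (h\<^sup>2 / r)" .
    moreover have "infdist z A \<le> dist z x" using x by (rule infdist_le)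
    moreover have "r + hausdorff_dist A B - dist z (x + r *\<^sub>R d) \<le> infdist z B"
      unfolding d_def using assms(6) by (rule external_hausdorff_dist_infdist_ge)
    moreover have "\<bar>infdist z A - infdist z B\<bar> \<le> grid_hausdorff_dist N A B"
      unfolding grid_hausdorff_dist_def
      using finite_uniform_grid[OF grid] \<open>z \<in> N\<close> by (intro Max_ge) auto
    ultimately show ?thesis by linarith
  qed
  show ?thesis
  \<comment> \<open>Both constants are set to 1, an arbitrary positive choice: \<open>bound\<close>
    holds for every spacing, and \<open>K * h ^ 3\<close> is positive slack.\<close>
  proof (intro exI[of _ 1] conjI allI impI)
    fix h :: real and N :: "(real ^ 'n) set"
    assume h: "uniform_grid h N \<and> h \<le> 1 \<and> large_enough h N A B r x y"
    then have "0 < h" unfolding uniform_grid_def by blast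
    then have "0 < 1 * h ^ 3" by simp
    with bound[of h N] h show "hausdorff_dist A B - grid_hausdorff_dist N A B
        \<le> real CARD('n) / 2 * (h\<^sup>2 / r) + 1 * h ^ 3"
      by linarith
  qed simp_all
qed

end
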